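(* Let $d=2$ and let $\mu$ be a probability measure on the set of subsets of $\{e_1,-e_1,e_2,-e_2\}\subset\mathbb{Z}^2$, with associated i.i.d. degenerate random environment $\mathcal{G}$ with law $\mathbb{P}$. Assume that $\mu(\mathcal{A}_{\{e_2,e_1\}})=1$, $\mu(\mathcal{A}_{\{e_2,-e_1\}})=1$, $\mu(\mathcal{A}_{\{-e_1\}})>0$, $\mu(\mathcal{A}_{\{e_1\}})>0$ and $\mu(\mathcal{A}_{\{e_2\}})>0$. Let $x\in\mathbb{Z}^2$. (a) $\mathbb{P}$-almost surely one of the following holds: (i) $\bar{\mathcal{C}}_x=\mathbb{Z}^2$; (ii) there exists a forward lower blocking function $W:\mathbb{Z}\to\mathbb{Z}$ such that $\bar{\mathcal{C}}_x=W_{\ge}$. (b) Only one of (i), (ii) can have probability different from $0$.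
   Context: Let $e_1=(1,0)$, $e_2=(0,1)$, $\mathcal{E}=\{\pm e_1,\pm e_2\}$. The degenerate random environment $\mathcal{G}=\{\mathcal{G}_x\}_{x\in\mathbb{Z}^2}$ consists of i.i.d. random subsets $\mathcal{G}_x$ of $\mathcal{E}$ with law $\mu$; $\mathbb{P}=\mu^{\otimes\mathbb{Z}^2}$. For $E\subset\mathcal{E}$, $\mathcal{A}_E$ is the event that a $\mu$-distributed subset $\mathcal{G}_o$ satisfies $\mathcal{G}_o\cap E\ne\varnothing$. Write $x\to y$ if there are $n\ge0$ and $x=x_0,\dots,x_n=y$ with $x_{i+1}-x_i\in\mathcal{G}_{x_i}$ for $0\le i\le n-1$. $\mathcal{C}_x=\{y:x\to y\}$, and $\bar{\mathcal{C}}_x$ is the set of $z\in\mathbb{Z}^2$ such that every infinite nearest-neighbour self-avoiding path in $\mathbb{Z}^2$ starting at $z$ passes through $\mathcal{C}_x$. For $w:\mathbb{Z}\to\mathbb{Z}$, let $w_{\ge}=\{(n,m)\in\mathbb{Z}^2:m\ge w(n)\}$ and $w_{<}=\{(n,m)\in\mathbb{Z}^2:m<w(n)\}$. $w$ is a forward lower blocking function if no point of $w_{\ge}$ is connected (via $\to$) to a point of $w_{<}$. *)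

theory Defs
  imports "HOL-Probability.Probability"
begin

type_synonym site = "int \<times> int"
type_synonym env = "site \<Rightarrow> site set"

abbreviation e1 :: site where "e1 \<equiv> (1, 0)"
abbreviation e2 :: site where "e2 \<equiv> (0, 1)"

definition dirs :: "site set" where
  "dirs = {e1, - e1, e2, - e2}"

definition is_dir_law :: "site set measure \<Rightarrow> bool" where
  "is_dir_law \<mu> \<longleftrightarrow> prob_space \<mu> \<and> space \<mu> = Pow dirs \<and> sets \<mu> = Pow (Pow dirs)"

definition env_law :: "site set measure \<Rightarrow> env measure" where
  "env_law \<mu> = (\<Pi>\<^sub>M x\<in>UNIV. \<mu>)"

definition hits :: "site set \<Rightarrow> site set set" where
  "hits E = {g \<in> Pow dirs. g \<inter> E \<noteq> {}}"

definition connected_to :: "env \<Rightarrow> site \<Rightarrow> site \<Rightarrow> bool" where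
  "connected_to G x y \<longleftrightarrow>
     (\<exists>(n::nat) p. p 0 = x \<and> p n = y \<and> (\<forall>i<n. p (Suc i) - p i \<in> G (p i)))"

definition cluster :: "env \<Rightarrow> site \<Rightarrow> site set" where
  "cluster G x = {y. connected_to G x y}"

definition self_avoiding_path_from :: "site \<Rightarrow> (nat \<Rightarrow> site) \<Rightarrow> bool" where
  "self_avoiding_path_from z p \<longleftrightarrow>
     p 0 = z \<and> (\<forall>i. p (Suc i) - p i \<in> dirs) \<and> inj p"

(* These paths are paths of the full lattice; they ignore the environment. *)
definition filled_cluster :: "env \<Rightarrow> site \<Rightarrow> site set" where
  "filled_cluster G x =
     {z. \<forall>p. self_avoiding_path_from z p \<longrightarrow> (\<exists>i. p i \<in> cluster G x)}"

definition region_ge :: "(int \<Rightarrow> int) \<Rightarrow> site set" where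
  "region_ge w = {(n, m). m \<ge> w n}"

definition region_less :: "(int \<Rightarrow> int) \<Rightarrow> site set" where
  "region_less w = {(n, m). m < w n}"

definition forward_lower_blocking :: "env \<Rightarrow> (int \<Rightarrow> int) \<Rightarrow> bool" where
  "forward_lower_blocking G w \<longleftrightarrow>
     (\<forall>u\<in>region_ge w. \<forall>v\<in>region_less w. \<not> connected_to G u v)"

end

(* Almost surely the cluster C of x, and more generally any set closed under following arrows, can
   be continued from each of its points by a path of right and up steps and by one of left and up
   steps. Over a point of C whose upper neighbour is not in C, the row below the gap lies in C up to
   sites carrying e2, and the two staircases starting there cross and enclose the gap. So the filled
   cluster contains everything above C. If a column of C is unbounded below and its neighbour is
   not, then the far part of the first column is contained in C and has no arrow towards the second
   one, which has probability 0. Thus C is unbounded below in all columns (and fills up to the plane)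
   or in none (and fills up to the region above its lower envelope).

   For (b), let D k be the event that the cluster of (x1, k) is bounded below. It is increasing in k
   and by translation invariance its probability is constant, so the D k coincide almost surely. By
   the same argument D k coincides with the event that for every finite box some (x1, m) has a
   cluster avoiding the box and everything below it, to which the 0-1 law applies. *)
theory Submission
  imports Defs
begin

section \<open>Sets closed under the arrows\<close>

text \<open>Collects the almost sure consequences of the five hypotheses on which the geometry
  rests; given them, it is deterministic. The local clauses leave a site without \<open>e2\<close>
  with both horizontal arrows.\<close>

definition good_env :: "env \<Rightarrow> bool" where
  "good_env G \<longleftrightarrow>
     (\<forall>y. G y \<subseteq> dirs \<and> (e2 \<in> G y \<or> e1 \<in> G y) \<and> (e2 \<in> G y \<or> - e1 \<in> G y)) \<and>
     (\<forall>n m. (\<exists>k\<ge>m. e1 \<in> G (n, k)) \<and> (\<exists>k\<ge>m. - e1 \<in> G (n, k)) \<and>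
            (\<exists>k\<le>m. e1 \<in> G (n, k)) \<and> (\<exists>k\<le>m. - e1 \<in> G (n, k)) \<and>
            (\<exists>k\<ge>n. e2 \<in> G (k, m)) \<and> (\<exists>k\<le>n. e2 \<in> G (k, m)))"

text \<open>Besides clusters this covers their mirror images, without identifying those as clusters,
  and the regions above blocking functions.\<close>

definition closed_under :: "env \<Rightarrow> site set \<Rightarrow> bool" where
  "closed_under G C \<longleftrightarrow> (\<forall>y\<in>C. \<forall>d\<in>G y. y + d \<in> C)"

definition reflect :: "site \<Rightarrow> site" where
  "reflect y = (- fst y, snd y)"

text \<open>Reflection in the vertical axis exchanges \<open>e1\<close> and \<open>- e1\<close>, so
  leftward statements follow from their rightward twins.\<close>

definition reflect_env :: "env \<Rightarrow> env" where
  "reflect_env G = (\<lambda>y. {d. reflect d \<in> G (reflect y)})"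

lemma dirs_eq: "dirs = {(1, 0), (-1, 0), (0, 1), (0, -1)}"
  by (auto simp: dirs_def)

lemma reflect_Pair [simp]: "reflect (n, m) = (- n, m)"
  by (simp add: reflect_def)

lemma closed_under_reflect:
  assumes "closed_under G C"
  shows "closed_under (reflect_env G) {y. reflect y \<in> C}"
  unfolding closed_under_def
proof (intro ballI)
  fix y d assume "y \<in> {y. reflect y \<in> C}" "d \<in> reflect_env G y"
  then have "reflect y + reflect d \<in> C"
    using assms by (auto simp: closed_under_def reflect_env_def)
  then show "y + d \<in> {y. reflect y \<in> C}"
    by (cases y; cases d) simp
qed

lemma ex_ge_uminus: "(\<exists>k\<ge>n. P (- k)) \<longleftrightarrow> (\<exists>k\<le>- n. P k)" for n :: int
  by (metis minus_le_iff minus_minus)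

lemma ex_le_uminus: "(\<exists>k\<le>n. P (- k)) \<longleftrightarrow> (\<exists>k\<ge>- n. P k)" for n :: int
  by (metis le_minus_iff minus_minus)

lemma good_env_dirs: "good_env G \<Longrightarrow> G y \<subseteq> dirs"
  unfolding good_env_def by blast

lemma good_env_reflect:
  assumes "good_env G"
  shows "good_env (reflect_env G)"
proof -
  have "reflect_env G y \<subseteq> dirs" for y
  proof
    fix d assume "d \<in> reflect_env G y"
    then have "reflect d \<in> dirs"
      using good_env_dirs[OF assms] unfolding reflect_env_def by blast
    then show "d \<in> dirs"
      by (cases d) (auto simp: dirs_eq)
  qed
  moreover have "\<exists>k\<ge>n. (0, 1) \<in> G (- k, m)" "\<exists>k\<le>n. (0, 1) \<in> G (- k, m)" for n m
    using assms ex_ge_uminus[of n "\<lambda>k. (0, 1) \<in> G (k, m)"]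
      ex_le_uminus[of n "\<lambda>k. (0, 1) \<in> G (k, m)"] unfolding good_env_def by blast+
  ultimately show ?thesis
    using assms unfolding good_env_def reflect_env_def by simp
qed

lemma good_env_e2: "good_env G \<Longrightarrow> e1 \<notin> G y \<or> - e1 \<notin> G y \<Longrightarrow> (0, 1) \<in> G y"
  unfolding good_env_def by blast

lemma closed_underD:
  assumes "closed_under G C" "(n, m) \<in> C"
  shows "(1, 0) \<in> G (n, m) \<Longrightarrow> (n + 1, m) \<in> C"
    and "(0, 1) \<in> G (n, m) \<Longrightarrow> (n, m + 1) \<in> C"
  using assms by (force simp: closed_under_def)+

section \<open>Staircases and the sets they enclose\<close>

text \<open>Go up column \<open>n\<close> to the first site carrying \<open>e1\<close>. The sites
  passed on the way lack \<open>e1\<close>, hence carry \<open>e2\<close>, so \<open>C\<close>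
  contains each next one.\<close>

lemma climb:
  assumes G: "good_env G" and C: "closed_under G C" and in_C: "(n, k) \<in> C"
  obtains k' where "k \<le> k'" "(n + 1, k') \<in> C" "\<And>j. k \<le> j \<Longrightarrow> j \<le> k' \<Longrightarrow> (n, j) \<in> C"
proof -
  obtain k1 where "k1 \<ge> k" "(1, 0) \<in> G (n, k1)"
    using G unfolding good_env_def by blast
  then have "\<exists>t::nat. (1, 0) \<in> G (n, k + int t)"
    by (intro exI[of _ "nat (k1 - k)"]) simp
  from exists_least_iff[THEN iffD1, OF this] obtain t :: nat where t: "(1, 0) \<in> G (n, k + int t)"
    and least: "\<And>s. s < t \<Longrightarrow> (1, 0) \<notin> G (n, k + int s)"
    by blast
  have up: "(n, k + int s) \<in> C" if "s \<le> t" for s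
    using that
  proof (induction s)
    case 0
    then show ?case using in_C by simp
  next
    case (Suc s)
    then have "(n, k + int s) \<in> C" "(0, 1) \<in> G (n, k + int s)"
      using least[of s] good_env_e2[OF G, of "(n, k + int s)"] by simp_all
    then show ?case
      using closed_underD(2)[OF C, of n "k + int s"] by (simp add: ac_simps)
  qed
  show thesis
  proof (rule that)
    show "k \<le> k + int t" by simp
    show "(n + 1, k + int t) \<in> C"
      using closed_underD(1)[OF C up[OF order_refl] t] .
    show "(n, j) \<in> C" if "k \<le> j" "j \<le> k + int t" for j
      using up[of "nat (j - k)"] that by simp
  qed
qed

text \<open>Iterates \<open>climb\<close>. Here \<open>f n\<close> is the height at which the
  staircase leaves column \<open>n\<close> to the right, so in column \<open>n + 1\<close> it
  occupies the heights from \<open>f n\<close> to \<open>f (n + 1)\<close>.\<close>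

lemma staircase:
  assumes G: "good_env G" and C: "closed_under G C" and in_C: "(c, h) \<in> C"
  obtains f :: "int \<Rightarrow> int" where
    "h \<le> f c" "\<And>k. h \<le> k \<Longrightarrow> k \<le> f c \<Longrightarrow> (c, k) \<in> C"
    "\<And>n. c \<le> n \<Longrightarrow> f n \<le> f (n + 1)"
    "\<And>n k. c \<le> n \<Longrightarrow> f n \<le> k \<Longrightarrow> k \<le> f (n + 1) \<Longrightarrow> (n + 1, k) \<in> C"
proof -
  \<comment> \<open>In \<open>P i t\<close>, \<open>t\<close> is the exit height of column
    \<open>c + int i\<close> and thus the entry height of the next column. The clause for
    \<open>i = 0\<close> remembers the climb in the starting column.\<close>
  define P where "P i t \<longleftrightarrow> (c + int i + 1, t) \<in> C \<and>
    (i = 0 \<longrightarrow> h \<le> t \<and> (\<forall>k. h \<le> k \<and> k \<le> t \<longrightarrow> (c, k) \<in> C))" for i t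
  define Q where "Q i t t' \<longleftrightarrow> t \<le> t' \<and> (\<forall>k. t \<le> k \<and> k \<le> t' \<longrightarrow> (c + int i + 1, k) \<in> C)"
    for i and t t' :: int
  have "\<exists>g. \<forall>i. P i (g i) \<and> Q i (g i) (g (Suc i))"
  proof (rule dependent_nat_choice)
    obtain k' where "h \<le> k'" "(c + 1, k') \<in> C" "\<And>j. h \<le> j \<Longrightarrow> j \<le> k' \<Longrightarrow> (c, j) \<in> C"
      using climb[OF G C in_C] by blast
    then show "\<exists>t. P 0 t" by (auto simp: P_def)
  next
    fix t i assume "P i t"
    then have "(c + int i + 1, t) \<in> C" by (simp add: P_def)
    from climb[OF G C this] obtain k' where "t \<le> k'" "(c + int i + 1 + 1, k') \<in> C"
      "\<And>j. t \<le> j \<Longrightarrow> j \<le> k' \<Longrightarrow> (c + int i + 1, j) \<in> C" by blast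
    then show "\<exists>t'. P (Suc i) t' \<and> Q i t t'"
      by (intro exI[of _ k']) (auto simp: P_def Q_def ac_simps)
  qed
  then obtain g where g: "\<And>i. P i (g i)" "\<And>i. Q i (g i) (g (Suc i))" by blast
  define f where "f n = g (nat (n - c))" for n
  have step: "Q (nat (n - c)) (f n) (f (n + 1))" if "c \<le> n" for n
    using g(2)[of "nat (n - c)"] that by (simp add: f_def Suc_nat_eq_nat_zadd1 algebra_simps)
  show thesis
  proof (rule that)
    show "h \<le> f c" "\<And>k. h \<le> k \<Longrightarrow> k \<le> f c \<Longrightarrow> (c, k) \<in> C"
      using g(1)[of 0] by (auto simp: P_def f_def)
    show "f n \<le> f (n + 1)" if "c \<le> n" for n
      using step[OF that] by (simp add: Q_def)
    show "(n + 1, k) \<in> C" if "c \<le> n" "f n \<le> k" "k \<le> f (n + 1)" for n k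
      using step[OF that(1)] that by (simp add: Q_def)
  qed
qed

lemma staircase_left:
  assumes G: "good_env G" and C: "closed_under G C" and in_C: "(c, h) \<in> C"
  obtains f :: "int \<Rightarrow> int" where
    "h \<le> f c" "\<And>k. h \<le> k \<Longrightarrow> k \<le> f c \<Longrightarrow> (c, k) \<in> C"
    "\<And>n. n \<le> c \<Longrightarrow> f n \<le> f (n - 1)"
    "\<And>n k. n \<le> c \<Longrightarrow> f n \<le> k \<Longrightarrow> k \<le> f (n - 1) \<Longrightarrow> (n - 1, k) \<in> C"
proof -
  have "(- c, h) \<in> {y. reflect y \<in> C}" using in_C by simp
  from staircase[OF good_env_reflect[OF G] closed_under_reflect[OF C] this]
  obtain f where f: "h \<le> f (- c)"
    "\<And>k. h \<le> k \<Longrightarrow> k \<le> f (- c) \<Longrightarrow> (- c, k) \<in> {y. reflect y \<in> C}"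
    "\<And>n. - c \<le> n \<Longrightarrow> f n \<le> f (n + 1)"
    "\<And>n k. - c \<le> n \<Longrightarrow> f n \<le> k \<Longrightarrow> k \<le> f (n + 1) \<Longrightarrow> (n + 1, k) \<in> {y. reflect y \<in> C}"
    by blast
  show thesis
  proof (rule that[of "\<lambda>n. f (- n)"])
    show "f (- n) \<le> f (- (n - 1))" if "n \<le> c" for n
      using f(3)[of "- n"] that by (simp add: algebra_simps)
    show "(n - 1, k) \<in> C" if "n \<le> c" "f (- n) \<le> k" "k \<le> f (- (n - 1))" for n k
      using f(4)[of "- n" k] that by (simp add: algebra_simps)
  qed (use f(1,2) in auto)
qed

lemma meets_every_column:
  assumes G: "good_env G" and C: "closed_under G C" and "C \<noteq> {}"
  shows "\<exists>k. (n, k) \<in> C"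
proof -
  obtain c h where in_C: "(c, h) \<in> C" using \<open>C \<noteq> {}\<close> by fast
  consider "n = c" | "c < n" | "n < c" by linarith
  then show ?thesis
  proof cases
    case 1
    then show ?thesis using in_C by blast
  next
    case 2
    from staircase[OF G C in_C] obtain f where
      mono: "\<And>n. c \<le> n \<Longrightarrow> f n \<le> f (n + 1)" and
      visited: "\<And>n k. c \<le> n \<Longrightarrow> f n \<le> k \<Longrightarrow> k \<le> f (n + 1) \<Longrightarrow> (n + 1, k) \<in> C"
      by metis
    show ?thesis using mono[of "n - 1"] visited[of "n - 1" "f (n - 1)"] 2 by auto
  next
    case 3
    from staircase_left[OF G C in_C] obtain f where
      mono: "\<And>n. n \<le> c \<Longrightarrow> f n \<le> f (n - 1)" and
      visited: "\<And>n k. n \<le> c \<Longrightarrow> f n \<le> k \<Longrightarrow> k \<le> f (n - 1) \<Longrightarrow> (n - 1, k) \<in> C"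
      by metis
    show ?thesis using mono[of "n + 1"] visited[of "n + 1" "f (n + 1)"] 3 by auto
  qed
qed

text \<open>The enclosing set S lies under a right staircase from the left end and under a left staircase from
  the right end.\<close>

lemma enclosure:
  assumes G: "good_env G" and C: "closed_under G C"
    and l: "(a - 1, h + 1) \<in> C" and r: "(b + 1, h + 1) \<in> C"
    and below: "\<And>n. a \<le> n \<Longrightarrow> n \<le> b \<Longrightarrow> (n, h) \<in> C"
    and c: "a \<le> c" "c \<le> b" "(c, h + 1) \<notin> C"
  obtains S where "finite S" "(c, h + 1) \<in> S" "\<And>u d. u \<in> S \<Longrightarrow> d \<in> dirs \<Longrightarrow> u + d \<in> S \<union> C"
proof -
  obtain f where f: "h + 1 \<le> f (a - 1)"
    "\<And>k. h + 1 \<le> k \<Longrightarrow> k \<le> f (a - 1) \<Longrightarrow> (a - 1, k) \<in> C"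
    "\<And>n. a - 1 \<le> n \<Longrightarrow> f n \<le> f (n + 1)"
    "\<And>n k. a - 1 \<le> n \<Longrightarrow> f n \<le> k \<Longrightarrow> k \<le> f (n + 1) \<Longrightarrow> (n + 1, k) \<in> C"
    using staircase[OF G C l] by blast
  obtain g where g: "h + 1 \<le> g (b + 1)"
    "\<And>k. h + 1 \<le> k \<Longrightarrow> k \<le> g (b + 1) \<Longrightarrow> (b + 1, k) \<in> C"
    "\<And>n. n \<le> b + 1 \<Longrightarrow> g n \<le> g (n - 1)"
    "\<And>n k. n \<le> b + 1 \<Longrightarrow> g n \<le> k \<Longrightarrow> k \<le> g (n - 1) \<Longrightarrow> (n - 1, k) \<in> C"
    using staircase_left[OF G C r] by blast
  have f_in: "(n, k) \<in> C" if "a \<le> n" "f (n - 1) \<le> k" "k \<le> f n" for n k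
    using f(4)[of "n - 1" k] that by simp
  have g_in: "(n, k) \<in> C" if "n \<le> b" "g (n + 1) \<le> k" "k \<le> g n" for n k
    using g(4)[of "n + 1" k] that by simp
  have f_mono: "f (n - 1) \<le> f n" if "a \<le> n" for n
    using f(3)[of "n - 1"] that by simp
  have g_mono: "g (n + 1) \<le> g n" if "n \<le> b" for n
    using g(3)[of "n + 1"] that by simp
  have f_ge: "h + 1 \<le> f n" if "a - 1 \<le> n" for n
    using that by (induction n rule: int_ge_induct) (use f(1,3) in \<open>auto intro: order_trans\<close>)
  have g_ge: "h + 1 \<le> g n" if "n \<le> b + 1" for n
    using that by (induction n rule: int_le_induct) (use g(1,3) in \<open>auto intro: order_trans\<close>)
  \<comment> \<open>In column \<open>n\<close> the right staircase enters at height
    \<open>f (n - 1)\<close> and the left one at \<open>g (n + 1)\<close>; \<open>S\<close> stays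
    strictly below both.\<close>
  define S where "S = {(n, k). a \<le> n \<and> n \<le> b \<and> h + 1 \<le> k \<and> k < f (n - 1) \<and> k < g (n + 1)}"
  show thesis
  proof (rule that)
    show "finite S"
    proof (rule finite_subset)
      show "S \<subseteq> (SIGMA n:{a..b}. {h + 1..f (n - 1)})" by (auto simp: S_def)
    qed auto
    \<comment> \<open>Neither bound can equal \<open>h + 1\<close>, since the entry points of the
      staircases in column \<open>c\<close> lie in \<open>C\<close>.\<close>
    show "(c, h + 1) \<in> S"
      using f_in[of c "h + 1"] g_in[of c "h + 1"] f_ge[of c] g_ge[of c] f_ge[of "c - 1"] g_ge[of "c + 1"] c
      by (force simp: S_def)
    fix u d assume "u \<in> S" "d \<in> dirs"
    then obtain n k where u: "u = (n, k)" "a \<le> n" "n \<le> b" "h + 1 \<le> k" "k < f (n - 1)" "k < g (n + 1)"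
      by (auto simp: S_def)
    consider "d = (1, 0)" | "d = (-1, 0)" | "d = (0, 1)" | "d = (0, -1)"
      using \<open>d \<in> dirs\<close> by (auto simp: dirs_eq)
    then show "u + d \<in> S \<union> C"
    proof cases
      case 1
      show ?thesis
      proof (cases "n = b")
        case True
        then show ?thesis using g(2)[of k] u 1 by simp
      next
        case False
        \<comment> \<open>Moving right only weakens the bound from \<open>f\<close>. If the bound
          from \<open>g\<close> fails, the target lies on the stretch of the left staircase between
          \<open>g (n + 2)\<close> and \<open>g (n + 1)\<close>.\<close>
        then show ?thesis
          using u 1 f_mono[of n] g_in[of "n + 1" k] by (force simp: S_def)
      qed
    next
      case 2
      show ?thesis
      proof (cases "n = a")
        case True
        then show ?thesis using f(2)[of k] u 2 by simp
      next
        case False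
        then show ?thesis
          using u 2 g_mono[of n] f_in[of "n - 1" k] by (force simp: S_def)
      qed
    next
      case 3
      then show ?thesis
        using u f_in[of n "k + 1"] g_in[of n "k + 1"] f_mono[of n] g_mono[of n]
        by (force simp: S_def)
    next
      case 4
      then show ?thesis
        using u below[of n] by (cases "k = h + 1") (auto simp: S_def)
    qed
  qed
qed

section \<open>Trapping the sites above a closed set\<close>

text \<open>The analogue of \<open>climb\<close> along a row: before the first site with
  \<open>e2\<close>, every site lacks \<open>e2\<close> and therefore carries
  \<open>e1\<close>.\<close>

lemma row_exit:
  assumes G: "good_env G" and C: "closed_under G C" and in_C: "(c, h) \<in> C"
  obtains b where "c \<le> b" "(b, h + 1) \<in> C" "\<And>n. c \<le> n \<Longrightarrow> n \<le> b \<Longrightarrow> (n, h) \<in> C"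
proof -
  obtain k1 where "k1 \<ge> c" "(0, 1) \<in> G (k1, h)"
    using G unfolding good_env_def by blast
  then have "\<exists>t::nat. (0, 1) \<in> G (c + int t, h)"
    by (intro exI[of _ "nat (k1 - c)"]) simp
  from exists_least_iff[THEN iffD1, OF this] obtain t :: nat where t: "(0, 1) \<in> G (c + int t, h)"
    and least: "\<And>s. s < t \<Longrightarrow> (0, 1) \<notin> G (c + int s, h)"
    by blast
  have along: "(c + int s, h) \<in> C" if "s \<le> t" for s
    using that
  proof (induction s)
    case 0
    then show ?case using in_C by simp
  next
    case (Suc s)
    then have "(c + int s, h) \<in> C" "(1, 0) \<in> G (c + int s, h)"
      using least[of s] good_env_e2[OF G, of "(c + int s, h)"] by auto
    then show ?case
      using closed_underD(1)[OF C, of "c + int s" h] by (simp add: ac_simps)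
  qed
  show thesis
  proof (rule that)
    show "c \<le> c + int t" by simp
    show "(c + int t, h + 1) \<in> C"
      using closed_underD(2)[OF C along[OF order_refl] t] .
    show "(n, h) \<in> C" if "c \<le> n" "n \<le> c + int t" for n
      using along[of "nat (n - c)"] that by simp
  qed
qed

lemma row_exit_left:
  assumes G: "good_env G" and C: "closed_under G C" and in_C: "(c, h) \<in> C"
  obtains a where "a \<le> c" "(a, h + 1) \<in> C" "\<And>n. a \<le> n \<Longrightarrow> n \<le> c \<Longrightarrow> (n, h) \<in> C"
proof -
  have "(- c, h) \<in> {y. reflect y \<in> C}" using in_C by simp
  from row_exit[OF good_env_reflect[OF G] closed_under_reflect[OF C] this]
  obtain b where b: "- c \<le> b" "(b, h + 1) \<in> {y. reflect y \<in> C}"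
    "\<And>n. - c \<le> n \<Longrightarrow> n \<le> b \<Longrightarrow> (n, h) \<in> {y. reflect y \<in> C}"
    by blast
  show thesis
  proof (rule that[of "- b"])
    show "(n, h) \<in> C" if "- b \<le> n" "n \<le> c" for n
      using b(3)[of "- n"] that by simp
  qed (use b(1,2) in auto)
qed

text \<open>A path avoiding \<open>C\<close> could never leave the finite set \<open>S\<close>, but
  an injective path has infinite range.\<close>

lemma self_avoiding_path_leaves_finite:
  assumes p: "self_avoiding_path_from z p" and "finite S" "z \<in> S"
    and exits: "\<And>u d. u \<in> S \<Longrightarrow> d \<in> dirs \<Longrightarrow> u + d \<in> S \<union> C"
  shows "\<exists>i. p i \<in> C"
proof (rule ccontr)
  assume "\<nexists>i. p i \<in> C"
  then have avoid: "p i \<notin> C" for i by blast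
  have "p i \<in> S" for i
  proof (induction i)
    case 0
    then show ?case using p \<open>z \<in> S\<close> by (simp add: self_avoiding_path_from_def)
  next
    case (Suc i)
    then have "p i + (p (Suc i) - p i) \<in> S \<union> C"
      using p by (intro exits) (auto simp: self_avoiding_path_from_def)
    then show ?case using avoid[of "Suc i"] by simp
  qed
  then have "range p \<subseteq> S" by blast
  moreover have "infinite (range p)"
    using p by (simp add: self_avoiding_path_from_def finite_image_iff)
  ultimately show False using \<open>finite S\<close> finite_subset by blast
qed

text \<open>Descend from the site to the nearest site of \<open>C\<close> below it. Row exits on
  both sides supply the corners for \<open>enclosure\<close>, and the resulting finite set contains
  the gap.\<close>

lemma above_is_enclosed:
  assumes G: "good_env G" and C: "closed_under G C" and in_C: "(c, m') \<in> C" and "m' \<le> m"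
    and p: "self_avoiding_path_from (c, m) p"
  shows "\<exists>i. p i \<in> C"
proof (cases "(c, m) \<in> C")
  case True
  then show ?thesis using p by (metis self_avoiding_path_from_def)
next
  case False
  have "\<exists>t::nat. (c, m - int t) \<in> C"
    using in_C \<open>m' \<le> m\<close> by (intro exI[of _ "nat (m - m')"]) simp
  from exists_least_iff[THEN iffD1, OF this] obtain t :: nat where t: "(c, m - int t) \<in> C"
    and least: "\<And>s. s < t \<Longrightarrow> (c, m - int s) \<notin> C"
    by blast
  define h where "h = m - int t"
  have "t > 0" using t False by (cases t) auto
  have h: "(c, h) \<in> C" "h < m" using t \<open>t > 0\<close> by (auto simp: h_def)
  have gap: "(c, k) \<notin> C" if "h < k" "k \<le> m" for k
    using least[of "nat (m - k)"] that by (simp add: h_def)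
  obtain b where b: "c \<le> b" "(b, h + 1) \<in> C" "\<And>n. c \<le> n \<Longrightarrow> n \<le> b \<Longrightarrow> (n, h) \<in> C"
    using row_exit[OF G C h(1)] by blast
  obtain a where a: "a \<le> c" "(a, h + 1) \<in> C" "\<And>n. a \<le> n \<Longrightarrow> n \<le> c \<Longrightarrow> (n, h) \<in> C"
    using row_exit_left[OF G C h(1)] by blast
  have nC: "(c, h + 1) \<notin> C" using gap h by simp
  \<comment> \<open>The exits are in \<open>C\<close> but the bottom of the gap is not, so they lie
    strictly on either side of column \<open>c\<close>; hence the bounds \<open>a + 1\<close> and
    \<open>b - 1\<close> below.\<close>
  have "a \<noteq> c" "b \<noteq> c" using a(2) b(2) nC by auto
  obtain S where S: "finite S" "(c, h + 1) \<in> S"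
    "\<And>u d. u \<in> S \<Longrightarrow> d \<in> dirs \<Longrightarrow> u + d \<in> S \<union> C"
  proof (rule enclosure[OF G C, of "a + 1" h "b - 1" c])
    show "(n, h) \<in> C" if "a + 1 \<le> n" "n \<le> b - 1" for n
      using that a(3)[of n] b(3)[of n] by (cases "n \<le> c") auto
  qed (use a b nC \<open>a \<noteq> c\<close> \<open>b \<noteq> c\<close> in auto)
  \<comment> \<open>A step out of \<open>S\<close> would land in \<open>C\<close>, which the gap
    does not meet, so the whole gap up to height \<open>m\<close> lies in \<open>S\<close>.\<close>
  have "k \<le> m \<longrightarrow> (c, k) \<in> S" if "h + 1 \<le> k" for k
    using that
  proof (induction k rule: int_ge_induct)
    case base
    then show ?case using S(2) by simp
  next
    case (step k)
    then show ?case
      using S(3)[of "(c, k)" "(0, 1)"] gap[of "k + 1"] by (auto simp: dirs_eq)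
  qed
  then have "(c, m) \<in> S" using h by simp
  then show ?thesis
    using self_avoiding_path_leaves_finite[OF p S(1) _ S(3)] by blast
qed

section \<open>Boundedness below, column by column\<close>

definition bounded_below_at :: "site set \<Rightarrow> int \<Rightarrow> bool" where
  "bounded_below_at C n \<longleftrightarrow> (\<exists>m. \<forall>k<m. (n, k) \<notin> C)"

lemma bounded_below_at_mono: "bounded_below_at C n \<Longrightarrow> D \<subseteq> C \<Longrightarrow> bounded_below_at D n"
  unfolding bounded_below_at_def by blast

lemma bounded_below_at_region_ge: "bounded_below_at (region_ge W) n"
  by (auto simp: bounded_below_at_def region_ge_def intro!: exI[of _ "W n"])

text \<open>Otherwise no site of \<open>C\<close> in column \<open>n\<close> below \<open>M\<close>
  has \<open>e1\<close>, so each has \<open>e2\<close> and \<open>C\<close> spreads upwards from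
  arbitrarily low sites. It then fills the column below \<open>M\<close>, including a site with
  \<open>e1\<close>.\<close>

lemma bounded_below_at_left:
  assumes G: "good_env G" and C: "closed_under G C" and bdd: "bounded_below_at C (n + 1)"
  shows "bounded_below_at C n"
proof (rule ccontr)
  assume unbdd: "\<not> bounded_below_at C n"
  obtain M where M: "\<And>k. k < M \<Longrightarrow> (n + 1, k) \<notin> C"
    using bdd by (auto simp: bounded_below_at_def)
  have no_right: "(1, 0) \<notin> G (n, k)" if "(n, k) \<in> C" "k < M" for k
    using closed_underD(1)[OF C that(1)] M[OF that(2)] by blast
  have all_in: "(n, k) \<in> C" if "k < M" for k
  proof -
    obtain k0 where k0: "k0 < k" "(n, k0) \<in> C"
      using unbdd by (auto simp: bounded_below_at_def)
    have "j < M \<longrightarrow> (n, j) \<in> C" if "k0 \<le> j" for j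
      using that
    proof (induction j rule: int_ge_induct)
      case base
      then show ?case using k0 by simp
    next
      case (step j)
      show ?case
      proof
        assume "j + 1 < M"
        then have "(n, j) \<in> C" "(1, 0) \<notin> G (n, j)" using step no_right by auto
        then show "(n, j + 1) \<in> C"
          using closed_underD(2)[OF C] good_env_e2[OF G] by blast
      qed
    qed
    then show ?thesis using k0 that by simp
  qed
  obtain k where "k \<le> M - 1" "(1, 0) \<in> G (n, k)"
    using G unfolding good_env_def by blast
  then show False using all_in[of k] no_right[of k] by simp
qed

lemma bounded_below_at_right:
  assumes G: "good_env G" and C: "closed_under G C" and bdd: "bounded_below_at C (n - 1)"
  shows "bounded_below_at C n"
proof -
  have "bounded_below_at {y. reflect y \<in> C} (- n)"
  proof (rule bounded_below_at_left[OF good_env_reflect[OF G] closed_under_reflect[OF C]])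
    show "bounded_below_at {y. reflect y \<in> C} (- n + 1)"
      using bdd by (simp add: bounded_below_at_def)
  qed
  then show ?thesis by (simp add: bounded_below_at_def)
qed

text \<open>Boundedness passes to both neighbouring columns, which lets later arguments change the
  column freely.\<close>

lemma bounded_below_everywhere:
  assumes "good_env G" "closed_under G C" "bounded_below_at C n"
  shows "bounded_below_at C n'"
proof (induction n' rule: int_induct[of _ n])
  case base
  then show ?case by fact
next
  case (step1 i)
  then show ?case using bounded_below_at_right[OF assms(1,2), of "i + 1"] by simp
next
  case (step2 i)
  then show ?case using bounded_below_at_left[OF assms(1,2), of "i - 1"] by simp
qed

section \<open>The filled cluster in a good environment\<close>

lemma connected_to_iff_rtrancl: "connected_to G x y \<longleftrightarrow> (x, y) \<in> {(u, v). v - u \<in> G u}\<^sup>*"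
  by (simp add: rtrancl_power relpow_fun_conv connected_to_def)

lemma connected_to_refl: "connected_to G x x"
  by (simp add: connected_to_iff_rtrancl)

lemma start_in_cluster: "x \<in> cluster G x"
  by (simp add: cluster_def connected_to_refl)

lemma closed_under_cluster: "closed_under G (cluster G x)"
  by (auto simp: closed_under_def cluster_def connected_to_iff_rtrancl intro: rtrancl_into_rtrancl)

lemma connected_to_closed:
  assumes "connected_to G u v" "u \<in> C" "closed_under G C"
  shows "v \<in> C"
  using assms(1)[unfolded connected_to_iff_rtrancl] assms(2)
proof (induction rule: rtrancl_induct)
  case (step y z)
  then show ?case
    using assms(3)[unfolded closed_under_def, rule_format, of y "z - y"] by auto
qed

lemma cluster_subset:
  assumes "x \<in> C" "closed_under G C"
  shows "cluster G x \<subseteq> C"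
  using connected_to_closed[OF _ assms] by (auto simp: cluster_def)

text \<open>The two regions are complementary, so forbidding paths between them amounts to
  forbidding single arrows.\<close>

lemma forward_lower_blocking_iff: "forward_lower_blocking G w \<longleftrightarrow> closed_under G (region_ge w)"
proof
  have compl: "v \<in> region_less w \<longleftrightarrow> v \<notin> region_ge w" for v
    by (auto simp: region_ge_def region_less_def)
  show "closed_under G (region_ge w)" if *: "forward_lower_blocking G w"
    unfolding closed_under_def
  proof (intro ballI)
    fix y d assume "y \<in> region_ge w" "d \<in> G y"
    then have "connected_to G y (y + d)"
      by (auto simp: connected_to_iff_rtrancl)
    then show "y + d \<in> region_ge w"
      using * \<open>y \<in> region_ge w\<close> compl unfolding forward_lower_blocking_def by blast
  qed
  show "forward_lower_blocking G w" if "closed_under G (region_ge w)"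
    using connected_to_closed[OF _ _ that] compl unfolding forward_lower_blocking_def by blast
qed

lemma filled_cluster_avoid:
  "z \<notin> filled_cluster G x \<longleftrightarrow> (\<exists>p. self_avoiding_path_from z p \<and> (\<forall>i. p i \<notin> cluster G x))"
  by (auto simp: filled_cluster_def)

lemma cluster_subset_filled_cluster: "cluster G x \<subseteq> filled_cluster G x"
  unfolding filled_cluster_def self_avoiding_path_from_def by blast

lemma straight_down: "self_avoiding_path_from (n, m) (\<lambda>i. (n, m - int i))"
  by (auto simp: self_avoiding_path_from_def dirs_eq inj_on_def)

lemma filled_cluster_above:
  assumes "good_env G" "(n, m') \<in> cluster G x" "m' \<le> m"
  shows "(n, m) \<in> filled_cluster G x"
  using above_is_enclosed[OF assms(1) closed_under_cluster assms(2,3)]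
  by (auto simp: filled_cluster_def)

lemma filled_cluster_unbounded:
  assumes G: "good_env G" and unbdd: "\<not> bounded_below_at (cluster G x) n"
  shows "filled_cluster G x = UNIV"
proof -
  have "(a, b) \<in> filled_cluster G x" for a b
  proof -
    have "\<not> bounded_below_at (cluster G x) a"
      using bounded_below_everywhere[OF G closed_under_cluster] unbdd by blast
    then obtain k where "k < b" "(a, k) \<in> cluster G x"
      by (auto simp: bounded_below_at_def)
    then show ?thesis using filled_cluster_above[OF G] by simp
  qed
  then show ?thesis by auto
qed

text \<open>\<open>W\<close> is the lower envelope of the cluster; sites under it escape straight
  down. It is blocking because an arrow crossing it would open an escape route for an enclosed
  site.\<close>

lemma filled_cluster_bounded:
  assumes G: "good_env G" and bdd: "bounded_below_at (cluster G x) n"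
  obtains W where "forward_lower_blocking G W" "filled_cluster G x = region_ge W"
proof -
  let ?C = "cluster G x"
  have "\<exists>w. (a, w) \<in> ?C \<and> (\<forall>k<w. (a, k) \<notin> ?C)" for a
  proof -
    obtain M where M: "\<And>k. k < M \<Longrightarrow> (a, k) \<notin> ?C"
      using bounded_below_everywhere[OF G closed_under_cluster bdd, of a]
      by (auto simp: bounded_below_at_def)
    obtain k where k: "(a, k) \<in> ?C"
      using meets_every_column[OF G closed_under_cluster] start_in_cluster by blast
    with M have "M \<le> k" by force
    with k have "\<exists>t::nat. (a, M + int t) \<in> ?C"
      by (intro exI[of _ "nat (k - M)"]) simp
    from exists_least_iff[THEN iffD1, OF this] obtain t :: nat where t: "(a, M + int t) \<in> ?C"
      and least: "\<And>s. s < t \<Longrightarrow> (a, M + int s) \<notin> ?C"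
    by blast
    have "(a, j) \<notin> ?C" if "j < M + int t" for j
      using that M[of j] least[of "nat (j - M)"] by (cases "j < M") auto
    with t show ?thesis by blast
  qed
  then obtain W where W: "\<And>a. (a, W a) \<in> ?C" "\<And>a k. k < W a \<Longrightarrow> (a, k) \<notin> ?C"
    by metis
  have sub: "?C \<subseteq> region_ge W"
  proof
    fix y assume "y \<in> ?C"
    then show "y \<in> region_ge W"
      using W(2)[of "snd y" "fst y"] by (cases y) (force simp: region_ge_def)
  qed
  have not_filled: "(a, k) \<notin> filled_cluster G x" if "k < W a" for a k
    unfolding filled_cluster_avoid using straight_down[of a k] W(2)[of _ a] that by force
  have eq: "filled_cluster G x = region_ge W"
  proof (rule set_eqI)
    fix y :: site
    obtain a k where y: "y = (a, k)" by (cases y)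
    show "y \<in> filled_cluster G x \<longleftrightarrow> y \<in> region_ge W"
      using not_filled[of k a] filled_cluster_above[OF G W(1)[of a], of k]
      by (force simp: region_ge_def y)
  qed
  have "closed_under G (region_ge W)"
    unfolding closed_under_def
  proof (intro ballI)
    fix y d assume y: "y \<in> region_ge W" and d: "d \<in> G y"
    show "y + d \<in> region_ge W"
    proof (rule ccontr)
      assume nin: "y + d \<notin> region_ge W"
      obtain a k where ak: "y = (a, k)" by (cases y)
      \<comment> \<open>The cluster is closed and lies in the region, so a crossing arrow starts off
        the cluster, hence strictly above the envelope. Vertical arrows from there stay in the
        region.\<close>
      have "y \<notin> ?C"
        using closed_under_cluster[of G x] d nin sub by (auto simp: closed_under_def)
      then have "k \<noteq> W a" using W(1)[of a] ak by auto
      then have "W a < k" using y by (auto simp: ak region_ge_def)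
      have "d \<in> dirs" using good_env_dirs[OF G] d by blast
      with nin \<open>W a < k\<close> have d_cases: "d = (1, 0) \<or> d = (-1, 0)"
        by (auto simp: dirs_eq ak region_ge_def)
      define b where "b = a + fst d"
      have b: "y + d = (b, k)" "k < W b" "b \<noteq> a"
        using nin d_cases by (auto simp: ak b_def region_ge_def)
      \<comment> \<open>y could escape by one sideways step and then straight down.\<close>
      define p where "p = (\<lambda>i. case i of 0 \<Rightarrow> y | Suc i \<Rightarrow> (b, k - int i))"
      have "self_avoiding_path_from y p"
        unfolding self_avoiding_path_from_def
      proof (intro conjI allI)
        show "p (Suc i) - p i \<in> dirs" for i
          using d_cases by (cases i) (auto simp: p_def ak b_def dirs_eq)
        show "inj p"
          using b(3) by (auto simp: inj_on_def p_def ak split: nat.splits)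
      qed (simp add: p_def)
      moreover have "p i \<notin> ?C" for i
        using \<open>y \<notin> ?C\<close> W(2)[of _ b] b(2) by (auto simp: p_def split: nat.splits)
      ultimately have "y \<notin> filled_cluster G x"
        unfolding filled_cluster_avoid by blast
      then show False using y eq by simp
    qed
  qed
  then show thesis using that eq forward_lower_blocking_iff by blast
qed

lemma filled_cluster_region_ge_bounded:
  assumes "filled_cluster G x = region_ge W"
  shows "bounded_below_at (cluster G x) n"
proof -
  have "cluster G x \<subseteq> region_ge W"
    using cluster_subset_filled_cluster assms by blast
  then show ?thesis
    by (rule bounded_below_at_mono[OF bounded_below_at_region_ge])
qed

lemma filled_cluster_UNIV_iff:
  assumes "good_env G"
  shows "filled_cluster G x = UNIV \<longleftrightarrow> \<not> bounded_below_at (cluster G x) n"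
proof -
  have "region_ge W \<noteq> UNIV" for W
    proof -
    have "(0, W 0 - 1) \<notin> region_ge W" by (simp add: region_ge_def)
    then show ?thesis by blast
  qed
  then show ?thesis
    by (metis assms filled_cluster_bounded filled_cluster_unbounded)
qed

text \<open>The two clusters need not be nested, but the higher start lies in the filled cluster of
  the lower one, whose blocking function confines both.\<close>

lemma bounded_below_cluster_up:
  assumes G: "good_env G" and bdd: "bounded_below_at (cluster G (n, m)) n'" and "m \<le> m'"
  shows "bounded_below_at (cluster G (n, m')) n''"
proof -
  obtain W where W: "forward_lower_blocking G W" "filled_cluster G (n, m) = region_ge W"
    using filled_cluster_bounded[OF G bdd] by blast
  have "(n, m') \<in> filled_cluster G (n, m)"
    using filled_cluster_above[OF G start_in_cluster] \<open>m \<le> m'\<close> by blast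
  then have "cluster G (n, m') \<subseteq> region_ge W"
    using W by (intro cluster_subset) (auto simp: forward_lower_blocking_iff)
  then show ?thesis
    by (rule bounded_below_at_mono[OF bounded_below_at_region_ge])
qed

section \<open>Translation invariance and the zero-one law\<close>

lemma cluster_translate:
  "cluster (\<lambda>y. G (y + v)) x = {z. z + v \<in> cluster G (x + v)}"
proof -
  have shift: "connected_to (\<lambda>y. G (y + v)) x z" if *: "connected_to G (x + v) (z + v)" for G v x z
  proof -
    obtain n p where p: "p 0 = x + v" "p n = z + v" "\<forall>i<n. p (Suc i) - p i \<in> G (p i)"
      using * unfolding connected_to_def by blast
    then show ?thesis
      unfolding connected_to_def by (intro exI[of _ n] exI[of _ "\<lambda>i. p i - v"]) simp
  qed
  have "connected_to G (x + v) (z + v)" if *: "connected_to (\<lambda>y. G (y + v)) x z" for z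
    using shift[of "\<lambda>y. G (y + v)" "x + v" "- v" "z + v"] * by simp
  with shift show ?thesis unfolding cluster_def by blast
qed

lemma bounded_below_at_translate:
  "bounded_below_at {z. z + (0, j) \<in> C} n \<longleftrightarrow> bounded_below_at C n"
proof
  assume "bounded_below_at {z. z + (0, j) \<in> C} n"
  then obtain m where m: "\<And>k. k < m \<Longrightarrow> (n, k + j) \<notin> C"
    by (auto simp: bounded_below_at_def)
  have "(n, k) \<notin> C" if "k < m + j" for k
    using m[of "k - j"] that by simp
  then show "bounded_below_at C n" unfolding bounded_below_at_def by blast
next
  assume "bounded_below_at C n"
  then obtain m where m: "\<And>k. k < m \<Longrightarrow> (n, k) \<notin> C"
    unfolding bounded_below_at_def by blast
  have "(n, k + j) \<notin> C" if "k < m - j" for k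
    using m[of "k + j"] that by simp
  then show "bounded_below_at {z. z + (0, j) \<in> C} n"
    unfolding bounded_below_at_def by auto
qed

text \<open>Successive events are nested up to null sets and equally likely, so their differences
  are null; countability of the indices gives a single exceptional null set.\<close>

lemma (in prob_space) AE_eq_if_mono_prob_eq:
  fixes Q :: "int \<Rightarrow> 'a \<Rightarrow> bool"
  assumes meas [measurable]: "\<And>k. Measurable.pred M (Q k)"
    and mono: "\<And>k. AE \<omega> in M. Q k \<omega> \<longrightarrow> Q (k + 1) \<omega>"
    and prob: "\<And>k. \<P>(\<omega> in M. Q (k + 1) \<omega>) = \<P>(\<omega> in M. Q k \<omega>)"
  shows "AE \<omega> in M. \<forall>k l. Q k \<omega> \<longrightarrow> Q l \<omega>"
proof -
  have "AE \<omega> in M. Q (k + 1) \<omega> \<longrightarrow> Q k \<omega>" for k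
  proof -
    have "\<P>(\<omega> in M. Q (k + 1) \<omega> \<and> \<not> Q k \<omega>) + \<P>(\<omega> in M. Q (k + 1) \<omega> \<and> Q k \<omega>)
        = \<P>(\<omega> in M. Q (k + 1) \<omega>)"
      by (subst finite_measure_Union[symmetric]) (auto intro!: arg_cong[where f = prob])
    moreover have "\<P>(\<omega> in M. Q (k + 1) \<omega> \<and> Q k \<omega>) = \<P>(\<omega> in M. Q k \<omega>)"
      by (rule finite_measure_eq_AE) (use mono[of k] in auto)
    ultimately have "\<P>(\<omega> in M. Q (k + 1) \<omega> \<and> \<not> Q k \<omega>) = 0"
      using prob[of k] by simp
    then show ?thesis by (subst (asm) prob_Collect_eq_0) auto
  qed
  then have "AE \<omega> in M. Q (k + 1) \<omega> \<longleftrightarrow> Q k \<omega>" for k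
    using mono[of k] by eventually_elim blast
  then have "AE \<omega> in M. \<forall>k. Q (k + 1) \<omega> \<longleftrightarrow> Q k \<omega>"
    unfolding AE_all_countable by blast
  then show ?thesis
  proof eventually_elim
    case (elim \<omega>)
    have "Q k \<omega> \<longleftrightarrow> Q 0 \<omega>" for k
    proof (induction k rule: int_induct[of _ 0])
      case (step2 i)
      then show ?case using elim[rule_format, of "i - 1"] by simp
    qed (use elim in auto)
    then show ?case by blast
  qed
qed

section \<open>The i.i.d. environment: translations, measurability, good environments\<close>

locale iid_env =
  fixes \<mu> :: "site set measure"
  assumes dir_law: "is_dir_law \<mu>"

sublocale iid_env \<subseteq> product_prob_space "\<lambda>_::site. \<mu>" UNIV
  using dir_law by (intro product_prob_spaceI) (simp add: is_dir_law_def)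

context iid_env
begin

abbreviation "\<Omega> \<equiv> env_law \<mu>"

lemma prob_space_env: "prob_space \<Omega>"
  unfolding env_law_def by (rule P.prob_space_axioms)

lemma space_env: "G \<in> space \<Omega> \<longleftrightarrow> (\<forall>y. G y \<subseteq> dirs)"
  using dir_law unfolding env_law_def is_dir_law_def
  by (simp add: space_PiM PiE_UNIV_domain Pi_iff del: split_paired_All)

lemma measurable_site [measurable]: "(\<lambda>G. G y) \<in> measurable \<Omega> \<mu>"
  unfolding env_law_def by measurable

lemma site_in_space: "G \<in> space \<Omega> \<Longrightarrow> G y \<in> space \<mu>"
  using measurable_space[OF measurable_site] .

lemma pred_dir [measurable]: "Measurable.pred \<Omega> (\<lambda>G. d \<in> G y)"
proof -
  have "Measurable.pred \<mu> (\<lambda>g. d \<in> g)"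
    using dir_law by (auto simp: pred_def is_dir_law_def)
  then show ?thesis by (rule measurable_compose[OF measurable_site])
qed

lemma measurable_translate: "(\<lambda>G y. G (y + v)) \<in> measurable \<Omega> \<Omega>"
  unfolding env_law_def
  by (intro measurable_PiM_single') (auto simp: space_PiM)

lemma env_translation_invariant: "distr \<Omega> \<Omega> (\<lambda>G y. G (y + v)) = \<Omega>"
  using distr_PiM_reindex[of UNIV "\<lambda>_. \<mu>" "\<lambda>y. y + v" UNIV] M.prob_space_axioms
  by (simp add: env_law_def restrict_def inj_on_def)

lemma prob_translate:
  assumes "Measurable.pred \<Omega> Q"
  shows "\<P>(G in \<Omega>. Q (\<lambda>y. G (y + v))) = \<P>(G in \<Omega>. Q G)"
proof -
  have "\<P>(G in \<Omega>. Q G) = measure (distr \<Omega> \<Omega> (\<lambda>G y. G (y + v))) {G \<in> space \<Omega>. Q G}"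
    by (simp add: env_translation_invariant)
  also have "\<dots> = \<P>(G in \<Omega>. Q (\<lambda>y. G (y + v)))"
    using assms measurable_space[OF measurable_translate, of _ v]
    by (subst measure_distr) (auto intro!: measurable_translate arg_cong[where f = "measure \<Omega>"])
  finally show ?thesis by simp
qed

text \<open>Induction on the path length: both the length and the last site before \<open>v\<close>
  range over countable sets.\<close>

lemma pred_cluster [measurable]: "Measurable.pred \<Omega> (\<lambda>G. v \<in> cluster G u)"
proof -
  have "Measurable.pred \<Omega> (\<lambda>G. (u, v) \<in> {(u, v). v - u \<in> G u} ^^ n)" for n
  proof (induction n arbitrary: v)
    case 0
    then show ?case by simp
  next
    case (Suc n)
    have "((u, v) \<in> {(u, v). v - u \<in> G u} ^^ Suc n) \<longleftrightarrow>
        (\<exists>y. (u, y) \<in> {(u, v). v - u \<in> G u} ^^ n \<and> v - y \<in> G y)" for G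
      by auto
    with Suc show ?case by simp
  qed
  then show ?thesis
    by (simp add: cluster_def connected_to_iff_rtrancl rtrancl_power)
qed

text \<open>The first \<open>n\<close> sites of \<open>s\<close> are distinct, hence independent,
  and all lack \<open>d\<close> with probability \<open>q ^ n\<close>, which tends to 0.\<close>

lemma AE_dir_hit:
  fixes s :: "nat \<Rightarrow> site"
  assumes "inj s" and pos: "measure \<mu> (hits {d}) > 0"
  shows "AE G in \<Omega>. \<exists>i. d \<in> G (s i)"
proof -
  interpret E: prob_space \<Omega> by (rule prob_space_env)
  define A where "A = space \<mu> - hits {d}"
  have hits: "hits {d} \<in> sets \<mu>" "A \<in> sets \<mu>"
    using dir_law by (auto simp: is_dir_law_def hits_def A_def)
  define q where "q = measure \<mu> A"
  have q: "q = 1 - measure \<mu> (hits {d})"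
    using M.prob_compl[OF hits(1)] by (simp add: q_def A_def)
  let ?B = "{G \<in> space \<Omega>. \<forall>i. d \<notin> G (s i)}"
  have "E.prob ?B \<le> q ^ n" for n
  proof -
    let ?J = "s ` {..<n}"
    have "E.prob ?B \<le> E.prob {G \<in> space \<Omega>. \<forall>y\<in>?J. G y \<in> A}"
    proof (rule E.finite_measure_mono)
      show "?B \<subseteq> {G \<in> space \<Omega>. \<forall>y\<in>?J. G y \<in> A}"
        by (auto simp: A_def hits_def intro: site_in_space)
      have "Measurable.pred \<Omega> (\<lambda>G. \<forall>y\<in>?J. G y \<in> A)"
        using hits(2) by (intro pred_intros_finite) auto
      then show "{G \<in> space \<Omega>. \<forall>y\<in>?J. G y \<in> A} \<in> E.events"
        by simp
    qed
    also have "E.prob {G \<in> space \<Omega>. \<forall>y\<in>?J. G y \<in> A} = (\<Prod>y\<in>?J. q)"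
      using emeasure_PiM_Collect[of ?J "\<lambda>_. A"] hits(2)
      by (simp add: E.emeasure_eq_measure[unfolded env_law_def] M.emeasure_eq_measure q_def
          env_law_def ennreal_power)
    also have "\<dots> = q ^ n"
      using \<open>inj s\<close> by (simp add: card_image inj_on_subset)
    finally show ?thesis .
  qed
  moreover have "(\<lambda>n. q ^ n) \<longlonglongrightarrow> 0"
    by (rule LIMSEQ_realpow_zero) (use pos q in \<open>auto simp: q_def\<close>)
  ultimately have "E.prob ?B \<le> 0"
    by (intro LIMSEQ_le_const) auto
  then have "E.prob ?B = 0" by (simp add: measure_le_0_iff)
  then have "AE G in \<Omega>. \<not> (\<forall>i. d \<notin> G (s i))"
    by (subst (asm) E.prob_Collect_eq_0) auto
  then show ?thesis by simp
qed

text \<open>The hypotheses of probability one hold at all countably many sites at once. Those of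
  positive probability are applied along vertical rays for \<open>e1\<close> and \<open>- e1\<close>
  and along horizontal rays for \<open>e2\<close>.\<close>

lemma AE_good_env:
  assumes "measure \<mu> (hits {e2, e1}) = 1" "measure \<mu> (hits {e2, - e1}) = 1"
    and "measure \<mu> (hits {- e1}) > 0" "measure \<mu> (hits {e1}) > 0" "measure \<mu> (hits {e2}) > 0"
  shows "AE G in \<Omega>. good_env G"
proof -
  have site: "AE G in \<Omega>. \<forall>y. G y \<in> hits E" if "measure \<mu> (hits E) = 1" for E
  proof -
    have "hits E \<in> sets \<mu>"
      using dir_law by (auto simp: is_dir_law_def hits_def)
    then have "AE g in \<mu>. g \<in> hits E"
      using that by (simp add: M.prob_eq_1)
    then show ?thesis
      unfolding AE_all_countable env_law_def by (intro allI AE_component) auto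
  qed
  have up: "AE G in \<Omega>. \<forall>n m. \<exists>k\<ge>m. d \<in> G (n, k)"
    and down: "AE G in \<Omega>. \<forall>n m. \<exists>k\<le>m. d \<in> G (n, k)"
    and right: "AE G in \<Omega>. \<forall>n m. \<exists>k\<ge>n. d \<in> G (k, m)"
    and left: "AE G in \<Omega>. \<forall>n m. \<exists>k\<le>n. d \<in> G (k, m)"
    if "measure \<mu> (hits {d}) > 0" for d
    unfolding AE_all_countable
  proof (safe, goal_cases)
    case (1 n m)
    from AE_dir_hit[OF _ that, of "\<lambda>i. (n, m + int i)"] show ?case
      by (auto simp: inj_on_def elim!: eventually_mono intro: exI[of _ "m + int _"])
  next
    case (2 n m)
    from AE_dir_hit[OF _ that, of "\<lambda>i. (n, m - int i)"] show ?case
      by (auto simp: inj_on_def elim!: eventually_mono intro: exI[of _ "m - int _"])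
  next
    case (3 n m)
    from AE_dir_hit[OF _ that, of "\<lambda>i. (n + int i, m)"] show ?case
      by (auto simp: inj_on_def elim!: eventually_mono intro: exI[of _ "n + int _"])
  next
    case (4 n m)
    from AE_dir_hit[OF _ that, of "\<lambda>i. (n - int i, m)"] show ?case
      by (auto simp: inj_on_def elim!: eventually_mono intro: exI[of _ "n - int _"])
  qed
  show ?thesis
    using site[OF assms(1)] site[OF assms(2)] up[OF assms(3)] up[OF assms(4)]
      down[OF assms(3)] down[OF assms(4)] right[OF assms(5)] left[OF assms(5)]
  proof eventually_elim
    case (elim G)
    have "G y \<subseteq> dirs \<and> (e2 \<in> G y \<or> e1 \<in> G y) \<and> (e2 \<in> G y \<or> - e1 \<in> G y)" for y
      using elim(1,2)[rule_format, of y] by (auto simp: hits_def)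
    with elim show ?case unfolding good_env_def by blast
  qed
qed

section \<open>Zero-one laws\<close>

text \<open>Reduces to Kolmogorov's law: after enumerating the sites, a property unaffected by
  finite changes is a tail event of the coordinates.\<close>

lemma zero_one_law:
  assumes meas: "Measurable.pred \<Omega> T"
    and inv: "\<And>G G'. \<lbrakk>G \<in> space \<Omega>; G' \<in> space \<Omega>; finite {y. G y \<noteq> G' y}; T G\<rbrakk> \<Longrightarrow> T G'"
  shows "(AE G in \<Omega>. T G) \<or> (AE G in \<Omega>. \<not> T G)"
proof -
  interpret E: prob_space \<Omega> by (rule prob_space_env)
  define e :: "nat \<Rightarrow> site" where "e = from_nat_into UNIV"
  have "bij e"
    unfolding e_def by (rule bij_betw_from_nat_into) (auto simp: finite_prod infinite_UNIV_int)
  then have "inj e" "surj e" by (auto simp: bij_def)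
  define A where
    "A = (\<lambda>i. sigma_sets (space \<Omega>) {(\<lambda>G. G (e i)) -` B \<inter> space \<Omega> | B. B \<in> sets \<mu>})"
  have "E.indep_vars (\<lambda>_. \<mu>) (\<lambda>i G. G (e i)) UNIV"
  proof (subst E.indep_vars_iff_distr_eq_PiM)
    have "distr \<Omega> \<mu> (\<lambda>G. G y) = \<mu>" for y
      using PiM_component[of y] by (simp add: env_law_def)
    then show "distr \<Omega> (Pi\<^sub>M UNIV (\<lambda>_. \<mu>)) (\<lambda>G. \<lambda>i\<in>UNIV. G (e i)) =
        Pi\<^sub>M UNIV (\<lambda>i. distr \<Omega> \<mu> (\<lambda>G. G (e i)))"
      using distr_PiM_reindex[of UNIV "\<lambda>_. \<mu>" e UNIV] M.prob_space_axioms \<open>inj e\<close>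
      by (simp add: env_law_def)
  qed auto
  then have indep: "E.indep_sets A UNIV"
    by (simp add: E.indep_vars_def A_def)
  have A_sub: "A i \<subseteq> Pow (space \<Omega>)" for i
    unfolding A_def by (auto dest: sigma_sets_into_sp[rotated])
  let ?T = "{G \<in> space \<Omega>. T G}"
  have "?T \<in> sigma_sets (space \<Omega>) (\<Union> (A ` {n..}))" for n
  proof -
    define N where "N = sigma (space \<Omega>) (\<Union> (A ` {n..}))"
    have N: "space N = space \<Omega>" "sets N = sigma_sets (space \<Omega>) (\<Union> (A ` {n..}))"
      using A_sub unfolding N_def by (auto intro!: space_measure_of sets_measure_of)
    obtain G0 where G0: "G0 \<in> space \<Omega>" using E.not_empty by blast
    \<comment> \<open>\<open>r\<close> overwrites the first \<open>n\<close> sites by the fixed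
      configuration \<open>G0\<close>. It depends measurably on the other coordinates and is a
      finite change, so the event is its own preimage under \<open>r\<close>.\<close>
    define r :: "env \<Rightarrow> env" where "r G = (\<lambda>y. if y \<in> e ` {..<n} then G0 y else G y)" for G
    have r_space: "r G \<in> space \<Omega>" if "G \<in> space \<Omega>" for G
      using that G0 by (auto simp: space_env r_def)
    have coord: "(\<lambda>G. r G y) \<in> measurable N \<mu>" for y
    proof (cases "y \<in> e ` {..<n}")
      case True
      then show ?thesis using site_in_space[OF G0, of y] by (simp add: r_def)
    next
      case False
      obtain i where y: "y = e i" using \<open>surj e\<close> by blast
      with False have "n \<le> i" by (metis imageI leI lessThan_iff)
      have "(\<lambda>G. G y) \<in> measurable N \<mu>"
      proof (rule measurableI)
        show "G y \<in> space \<mu>" if "G \<in> space N" for G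
          using that site_in_space by (simp add: N)
        fix B assume "B \<in> sets \<mu>"
        then have "(\<lambda>G. G y) -` B \<inter> space \<Omega> \<in> A i"
          unfolding A_def y by (intro sigma_sets.Basic) blast
        then show "(\<lambda>G. G y) -` B \<inter> space N \<in> sets N"
          unfolding N using \<open>n \<le> i\<close> by (intro sigma_sets.Basic) auto
      qed
      then show ?thesis using False by (simp add: r_def)
    qed
    have "r \<in> measurable N \<Omega>"
      unfolding env_law_def
    proof (rule measurable_PiM_single'[of UNIV "\<lambda>y G. r G y" N "\<lambda>_. \<mu>"])
      show "(\<lambda>G y. r G y) \<in> space N \<rightarrow> (\<Pi>\<^sub>E y\<in>UNIV. space \<mu>)"
        using coord[THEN measurable_space] by auto
    qed (use coord in auto)
    then have "r -` ?T \<inter> space N \<in> sets N"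
      using meas by (auto intro: measurable_sets)
    moreover have "r -` ?T \<inter> space N = ?T"
    proof -
      have "finite {y. G y \<noteq> r G y}" "finite {y. r G y \<noteq> G y}" for G
        by (rule finite_subset[of _ "e ` {..<n}"]; auto simp: r_def)+
      then show ?thesis
        using inv r_space by (auto simp: N)
    qed
    ultimately show ?thesis using N by simp
  qed
  then have "?T \<in> E.tail_events A"
    by (simp add: E.tail_events_def)
  moreover have "sigma_algebra (space \<Omega>) (A i)" for i
    unfolding A_def by (rule sigma_algebra_sigma_sets) auto
  ultimately have "E.prob ?T = 0 \<or> E.prob ?T = 1"
    using E.kolmogorov_0_1_law[OF _ indep] by blast
  then show ?thesis
    using meas by (auto simp: E.prob_Collect_eq_0 E.prob_Collect_eq_1)
qed

lemma bounded_below_zero_one: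
  assumes good: "AE G in \<Omega>. good_env G"
  shows "(AE G in \<Omega>. bounded_below_at (cluster G (a, b)) a) \<or>
         (AE G in \<Omega>. \<not> bounded_below_at (cluster G (a, b)) a)"
proof -
  interpret E: prob_space \<Omega> by (rule prob_space_env)
  define D where "D k G \<longleftrightarrow> bounded_below_at (cluster G (a, k)) a" for k G
  define S where "S N K G \<longleftrightarrow>
    (\<exists>m. \<forall>n. \<bar>n\<bar> \<le> N \<longrightarrow> (\<forall>k<K. (n, k) \<notin> cluster G (a, m)))" for N K :: int and G
  \<comment> \<open>Unlike D b, T is invariant under every finite modification, not only almost surely: the
    clusters that avoid the modified sites do not change.\<close>
  define T where "T G \<longleftrightarrow> (\<forall>N K. S N K G)" for G
  have D_meas [measurable]: "Measurable.pred \<Omega> (D k)" for k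
    unfolding D_def bounded_below_at_def by measurable
  have S_meas [measurable]: "Measurable.pred \<Omega> (S N K)" for N K
    unfolding S_def by measurable
  have T_meas: "Measurable.pred \<Omega> T"
    unfolding T_def by measurable
  have "D k (\<lambda>y. G (y + (0, 1))) \<longleftrightarrow> D (k + 1) G" for k G
    by (simp add: D_def cluster_translate bounded_below_at_translate)
  then have "\<P>(G in \<Omega>. D (k + 1) G) = \<P>(G in \<Omega>. D k G)" for k
    using prob_translate[OF D_meas[of k], of "(0, 1)"] by simp
  moreover have "AE G in \<Omega>. D k G \<longrightarrow> D (k + 1) G" for k
    using good by eventually_elim (auto simp: D_def intro: bounded_below_cluster_up)
  ultimately have D_all: "AE G in \<Omega>. \<forall>k l. D k G \<longrightarrow> D l G"
    by (intro E.AE_eq_if_mono_prob_eq) auto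
  \<comment> \<open>The shift raises the height bound by one and moves the start, but the start
    \<open>m\<close> is quantified away.\<close>
  have S_shift: "S N K (\<lambda>y. G (y + (0, 1))) \<longleftrightarrow> S N (K + 1) G" for N K G
  proof -
    have "(\<forall>k<K. (n, k + 1) \<notin> C) \<longleftrightarrow> (\<forall>k<K + 1. (n, k) \<notin> C)" for C and n :: int
    proof safe
      fix k assume "\<forall>k<K. (n, k + 1) \<notin> C" "k < K + 1" "(n, k) \<in> C"
      then show False by (auto dest: spec[of _ "k - 1"])
    qed auto
    then have "S N K (\<lambda>y. G (y + (0, 1))) \<longleftrightarrow>
        (\<exists>m. \<forall>n. \<bar>n\<bar> \<le> N \<longrightarrow> (\<forall>k<K + 1. (n, k) \<notin> cluster G (a, m + 1)))"
      unfolding S_def cluster_translate by simp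
    also have "\<dots> \<longleftrightarrow> S N (K + 1) G"
      unfolding S_def by (metis diff_add_cancel)
    finally show ?thesis .
  qed
  have S_prob: "\<P>(G in \<Omega>. S N (K + 1) G) = \<P>(G in \<Omega>. S N K G)" for N K
    using prob_translate[OF S_meas[of N K], of "(0, 1)"] by (simp add: S_shift)
  \<comment> \<open>\<open>S N K\<close> decreases in \<open>K\<close>; the sign is flipped to
    obtain the increasing family that \<open>AE_eq_if_mono_prob_eq\<close> expects.\<close>
  have S_prob': "\<P>(G in \<Omega>. S N (- (k + 1)) G) = \<P>(G in \<Omega>. S N (- k) G)" for N k
    using S_prob[of N "- (k + 1)"] by simp
  have S_mono: "S N K G \<Longrightarrow> K' \<le> K \<Longrightarrow> S N K' G" for N K K' G
    unfolding S_def by (meson less_le_trans)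
  have "AE G in \<Omega>. \<forall>k l. S N (- k) G \<longrightarrow> S N (- l) G" for N
    by (intro E.AE_eq_if_mono_prob_eq S_prob') (auto intro!: AE_I2 elim: S_mono)
  then have S_all: "AE G in \<Omega>. \<forall>N k l. S N (- k) G \<longrightarrow> S N (- l) G"
    by (subst AE_all_countable) blast
  have T_iff: "AE G in \<Omega>. T G \<longleftrightarrow> D b G"
    using good D_all S_all
  proof eventually_elim
    case (elim G)
    show ?case
    proof
      assume "T G"
      then have "S \<bar>a\<bar> 0 G" by (simp add: T_def)
      then obtain m where "D m G" by (auto simp: S_def D_def bounded_below_at_def)
      then show "D b G" using elim(2) by blast
    next
      assume "D b G"
      then have "\<forall>n. \<exists>M. \<forall>k<M. (n, k) \<notin> cluster G (a, b)"
        using bounded_below_everywhere[OF elim(1) closed_under_cluster]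
        unfolding D_def bounded_below_at_def by blast
      then obtain M where M: "\<And>n k. k < M n \<Longrightarrow> (n, k) \<notin> cluster G (a, b)" by metis
      have "S N K G" for N K
      proof -
        \<comment> \<open>Finitely many columns have a common lower bound \<open>K0\<close>, and
          \<open>elim(3)\<close> replaces it by the desired \<open>K\<close>. For
          \<open>N < 0\<close> the minimum is unspecified, but \<open>S N K0 G\<close> holds
          vacuously.\<close>
        define K0 where "K0 = Min (M ` {- N..N})"
        have "K0 \<le> M n" if "\<bar>n\<bar> \<le> N" for n
          unfolding K0_def using that by (intro Min_le imageI) auto
        then have "S N K0 G"
          unfolding S_def using M by (meson less_le_trans)
        then show ?thesis
          using elim(3)[rule_format, of N "- K0" "- K"] by simp
      qed
      then show "T G" by (simp add: T_def)
    qed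
  qed
  have "(AE G in \<Omega>. T G) \<or> (AE G in \<Omega>. \<not> T G)"
  proof (rule zero_one_law[OF T_meas])
    fix G G' :: env
    assume fin: "finite {y. G y \<noteq> G' y}" and "T G"
    \<comment> \<open>\<open>R\<close> dominates both coordinates of every changed site, so a window
      of width \<open>R\<close> and height bound \<open>R + 1\<close> contains them all.\<close>
    define R where "R = (\<Sum>y | G y \<noteq> G' y. \<bar>fst y\<bar> + \<bar>snd y\<bar>)"
    have R: "\<bar>n\<bar> \<le> R" "k < R + 1" if "G (n, k) \<noteq> G' (n, k)" for n k
      using member_le_sum[of "(n, k)" "{y. G y \<noteq> G' y}" "\<lambda>y. \<bar>fst y\<bar> + \<bar>snd y\<bar>"] fin that
      by (auto simp: R_def)
    have "S N K G'" for N K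
    proof -
      have "S (max N R) (max K (R + 1)) G" using \<open>T G\<close> by (simp add: T_def)
      then obtain m where m: "\<And>n k. \<bar>n\<bar> \<le> max N R \<Longrightarrow> k < max K (R + 1) \<Longrightarrow>
          (n, k) \<notin> cluster G (a, m)"
        unfolding S_def by blast
      \<comment> \<open>The chosen cluster avoids the enlarged window and with it all changed sites.
        Hence it is also closed under \<open>G'\<close> and contains the new cluster from the same
        start.\<close>
      have "G y = G' y" if "y \<in> cluster G (a, m)" for y
        using m[of "fst y" "snd y"] R[of "fst y" "snd y"] that by (cases y) fastforce
      then have "closed_under G' (cluster G (a, m))"
        using closed_under_cluster[of G "(a, m)"] by (simp add: closed_under_def)
      then have "cluster G' (a, m) \<subseteq> cluster G (a, m)"
        using start_in_cluster by (intro cluster_subset)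
      then show ?thesis
        unfolding S_def using m by (intro exI[of _ m]) auto
    qed
    then show "T G'" by (simp add: T_def)
  qed
  then show ?thesis
  proof
    assume "AE G in \<Omega>. T G"
    with T_iff have "AE G in \<Omega>. D b G" by eventually_elim blast
    then show ?thesis by (simp add: D_def)
  next
    assume "AE G in \<Omega>. \<not> T G"
    with T_iff have "AE G in \<Omega>. \<not> D b G" by eventually_elim blast
    then show ?thesis by (simp add: D_def)
  qed
qed

end

section \<open>The dichotomy for the filled cluster\<close>

theorem proposition2p5:
  fixes \<mu> :: "site set measure" and x :: site
  assumes "is_dir_law \<mu>"
    and "measure \<mu> (hits {e2, e1}) = 1"
    and "measure \<mu> (hits {e2, - e1}) = 1"
    and "measure \<mu> (hits {- e1}) > 0"
    and "measure \<mu> (hits {e1}) > 0"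
    and "measure \<mu> (hits {e2}) > 0"
  shows
    "(AE G in env_law \<mu>.
        filled_cluster G x = UNIV \<or>
        (\<exists>W. forward_lower_blocking G W \<and> filled_cluster G x = region_ge W))
     \<and> ((AE G in env_law \<mu>. \<not> filled_cluster G x = UNIV) \<or>
        (AE G in env_law \<mu>.
           \<not> (\<exists>W. forward_lower_blocking G W \<and> filled_cluster G x = region_ge W)))"
proof -
  interpret iid_env \<mu> by standard fact
  have good: "AE G in env_law \<mu>. good_env G"
    using assms by (intro AE_good_env)
  have "AE G in env_law \<mu>.
        filled_cluster G x = UNIV \<or>
        (\<exists>W. forward_lower_blocking G W \<and> filled_cluster G x = region_ge W)"
    using good
  proof eventually_elim
    case (elim G)
    then show ?case
      by (metis filled_cluster_bounded filled_cluster_unbounded)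
  qed
  \<comment> \<open>A cluster bounded below excludes the whole plane in a good environment, and an
    unbounded one excludes every region \<open>region_ge W\<close>, so the zero-one law for
    boundedness rules out one alternative.\<close>
  moreover have "(AE G in env_law \<mu>. bounded_below_at (cluster G x) (fst x)) \<or>
      (AE G in env_law \<mu>. \<not> bounded_below_at (cluster G x) (fst x))"
    using bounded_below_zero_one[OF good, of "fst x" "snd x"] by simp
  then have "(AE G in env_law \<mu>. \<not> filled_cluster G x = UNIV) \<or>
        (AE G in env_law \<mu>.
           \<not> (\<exists>W. forward_lower_blocking G W \<and> filled_cluster G x = region_ge W))"
  proof
    assume "AE G in env_law \<mu>. bounded_below_at (cluster G x) (fst x)"
    with good have "AE G in env_law \<mu>. \<not> filled_cluster G x = UNIV"
      by eventually_elim (simp add: filled_cluster_UNIV_iff[where n = "fst x"])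
    then show ?thesis ..
  next
    assume "AE G in env_law \<mu>. \<not> bounded_below_at (cluster G x) (fst x)"
    then have "AE G in env_law \<mu>.
        \<not> (\<exists>W. forward_lower_blocking G W \<and> filled_cluster G x = region_ge W)"
      by eventually_elim (blast dest: filled_cluster_region_ge_bounded)
    then show ?thesis ..
  qed
  ultimately show ?thesis ..
qed

end
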